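(* Let $\mathscr{A}=\{a_1,\ldots,a_n\}\subset\mathbb{Z}$ be a finite set with $0<a_1<\cdots<a_n$, $\gcd(a_1,\ldots,a_n)=1$ and $1<a_1$. Let $m\in\mathbb{N}$ be such that $a_1<F_{m+1}$ or $a_2<F_{m+2}$. Then $\delta(\mathscr{A})<m$.
   Context: Fibonacci sequence (with this indexing): $F_1:=1$, $F_2:=2$, $F_{m+2}:=F_{m+1}+F_m$ for $m\geq1$. For a finite set $\mathscr{A}=\{a_1,\ldots,a_n\}$ of integers with $0<a_1<\cdots<a_n$ and gcd $1$, put $\mathscr{A}':=\{a_1\}\cup\{a_2-a_1,\ldots,a_n-a_1\}$ (a set of positive integers with gcd $1$, reordered increasingly), $\mathscr{A}^1:=\mathscr{A}'$, and $\mathscr{A}^k:=(\mathscr{A}^{k-1})'$ for $k\geq2$. The algorithm iterates $\mathscr{A}\mapsto\mathscr{A}'$ until the set contains $1$. Number of division algorithms $\delta(\mathscr{A})$ (for $a_1>1$): the iteration is grouped into division algorithms as follows. Start with $\mathscr{B}:=\mathscr{A}$. While $\min(\mathscr{B})>1$: first discard from $\mathscr{B}$ all multiples of $\min(\mathscr{B})$ other than $\min(\mathscr{B})$ itself; let $b_1<b_2$ be the two smallest elements of the resulting set $\mathscr{B}$ (it has at least two elements since its gcd is $1$ and $b_1>1$); perform the division $b_2=b_1q+r$ with $0<r<b_1$; then replace $\mathscr{B}$ by $\mathscr{B}^q$, whose minimum is $r$. Each pass through this loop counts as one division algorithm, and $\delta(\mathscr{A})$ is the total number of passes until $1$ belongs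 to the set. *)

theory Defs
  imports Main "HOL-Number_Theory.Fib"
begin

text \<open>
  The Fibonacci sequence normalised by \<open>F\<^sub>1 = 1\<close>, \<open>F\<^sub>2 = 2\<close>, that is, the library's sequence
  shifted by one.
\<close>

definition Fseq :: "nat \<Rightarrow> nat" where
  "Fseq m = fib (m + 1)"

lemma Fseq_1: "Fseq 1 = 1"
  and Fseq_2: "Fseq 2 = 2"
  and Fseq_add_2: "Fseq (m + 2) = Fseq (m + 1) + Fseq m"
  by (simp_all add: Fseq_def numeral_eq_Suc)

definition diff_step :: "int set \<Rightarrow> int set" where
  "diff_step A = insert (Min A) ((\<lambda>x. x - Min A) ` (A - {Min A}))"

definition prune :: "int set \<Rightarrow> int set" where
  "prune B = {b \<in> B. b = Min B \<or> \<not> Min B dvd b}"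

definition second_Min :: "int set \<Rightarrow> int" where
  "second_Min B = Min (B - {Min B})"

text \<open>
  One division algorithm.  The quotient is taken, and \<open>diff_step\<close> is iterated, on the set from
  which the proper multiples of the minimum have already been discarded.
\<close>

definition division_pass :: "int set \<Rightarrow> int set" where
  "division_pass B =
    (let C = prune B; q = second_Min C div Min C in (diff_step ^^ nat q) C)"

text \<open>
  Only meaningful for finite sets of positive integers with gcd 1.  For these the minimum drops
  in each pass (lemma \<open>Min_division_pass\<close>), so a suitable \<open>k\<close> exists, and \<open>delta\<close> counts the
  passes of the loop that runs while the minimum exceeds 1 (lemma \<open>delta_rec\<close>).
\<close>

definition delta :: "int set \<Rightarrow> nat" where
  "delta A = (LEAST k. 1 \<in> (division_pass ^^ k) A)"

definition admissible :: "int set \<Rightarrow> bool" where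
  "admissible A \<longleftrightarrow> finite A \<and> A \<noteq> {} \<and> (\<forall>a\<in>A. 0 < a) \<and> Gcd A = 1"

lemma Min_admissible:
  assumes "admissible A"
  shows "Min A \<in> A" and "0 < Min A" and "x \<in> A \<Longrightarrow> Min A \<le> x"
  using assms unfolding admissible_def by auto

lemma admissibleI:
  assumes "admissible A" "finite B" "B \<noteq> {}" "\<And>b. b \<in> B \<Longrightarrow> 0 < b"
    and "\<And>d a. (\<And>b. b \<in> B \<Longrightarrow> d dvd b) \<Longrightarrow> a \<in> A \<Longrightarrow> d dvd a"
  shows "admissible B"
proof -
  have "Gcd B dvd a" if "a \<in> A" for a
    using assms(5)[OF Gcd_dvd that] .
  then have "Gcd B dvd Gcd A" by (rule Gcd_greatest)
  then have "Gcd B = 1" using assms(1) by (simp add: admissible_def)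
  then show ?thesis using assms(2-4) by (simp add: admissible_def)
qed

lemma admissible_diff_step:
  assumes "admissible A"
  shows "admissible (diff_step A)"
proof (rule admissibleI[OF assms])
  note M = Min_admissible[OF assms]
  show "finite (diff_step A)" using assms by (simp add: diff_step_def admissible_def)
  show "diff_step A \<noteq> {}" by (simp add: diff_step_def)
  show "0 < b" if "b \<in> diff_step A" for b
    using that M by (fastforce simp: diff_step_def)
  show "d dvd a" if d: "\<And>b. b \<in> diff_step A \<Longrightarrow> d dvd b" and a: "a \<in> A" for d a
  proof (cases "a = Min A")
    case True
    then show ?thesis using d by (simp add: diff_step_def)
  next
    case False
    then have "d dvd a - Min A" "d dvd Min A"
      using d a by (auto simp: diff_step_def)
    then show ?thesis by (metis diff_add_cancel dvd_add)
  qed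
qed

lemma Min_prune:
  assumes "admissible A"
  shows "Min (prune A) = Min A"
  using assms Min_admissible[OF assms]
  by (intro Min_eqI) (auto simp: prune_def admissible_def)

lemma admissible_prune:
  assumes "admissible A"
  shows "admissible (prune A)"
proof (rule admissibleI[OF assms])
  note M = Min_admissible[OF assms]
  show "finite (prune A)" using assms by (simp add: prune_def admissible_def)
  show "prune A \<noteq> {}" using M(1) by (auto simp: prune_def)
  show "0 < b" if "b \<in> prune A" for b
    using that assms by (auto simp: prune_def admissible_def)
  show "d dvd a" if d: "\<And>b. b \<in> prune A \<Longrightarrow> d dvd b" and a: "a \<in> A" for d a
  proof (cases "a \<in> prune A")
    case False
    then have "Min A dvd a" using a by (auto simp: prune_def)
    moreover have "d dvd Min A" using d M(1) by (auto simp: prune_def)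
    ultimately show ?thesis by (rule dvd_trans[rotated])
  qed (use d in blast)
qed

lemma admissible_division_pass:
  assumes "admissible A"
  shows "admissible (division_pass A)"
proof -
  have "admissible ((diff_step ^^ k) (prune A))" for k
    by (induction k) (use assms in \<open>auto intro: admissible_prune admissible_diff_step\<close>)
  then show ?thesis by (simp add: division_pass_def Let_def)
qed

lemma prune_has_two:
  assumes "admissible A" "1 < Min A"
  shows "prune A - {Min A} \<noteq> {}"
proof
  assume "prune A - {Min A} = {}"
  moreover have "admissible (prune A)" using admissible_prune[OF assms(1)] .
  ultimately have "prune A = {Min A}" "Gcd (prune A) = 1"
    by (auto simp: admissible_def)
  then show False using assms(2) by simp
qed

lemma Min_division_pass:
  assumes A: "admissible A" "1 < Min A"
  shows "Min (division_pass A) = second_Min (prune A) mod Min A"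
    and "0 < second_Min (prune A) mod Min A"
    and "second_Min (prune A) mod Min A < Min A"
proof -
  define C where "C = prune A"
  define b where "b = Min A"
  define c where "c = second_Min C"
  define D where "D = C - {b}"
  have C: "admissible C" and MC: "Min C = b"
    using admissible_prune Min_prune A by (auto simp: C_def b_def)
  have D: "finite D" "D \<noteq> {}"
    using C prune_has_two[OF A] by (auto simp: D_def C_def b_def admissible_def)
  have c_Min: "c = Min D" by (simp add: c_def second_Min_def D_def MC)
  have c: "c \<in> D" and cle: "x \<in> D \<Longrightarrow> c \<le> x" for x
    using D by (auto simp: c_Min)
  have ndvd: "\<not> b dvd x" if "x \<in> D" for x
    using that by (auto simp: D_def C_def prune_def b_def)
  have CD: "C = insert b D"
    using Min_admissible(1)[OF C] MC by (auto simp: D_def)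
  have b: "b > 1" using A by (simp add: b_def)
  have c_pos: "0 < c" using c C by (auto simp: D_def admissible_def)
  show pos: "0 < second_Min (prune A) mod Min A"
    using ndvd[OF c] b unfolding C_def[symmetric] c_def[symmetric] b_def[symmetric]
    by (simp add: dvd_eq_mod_eq_0 order_less_le)
  show less: "second_Min (prune A) mod Min A < Min A"
    using A(2) by simp
  define q where "q = c div b"
  have q0: "q \<ge> 0" using b c_pos by (simp add: q_def pos_imp_zdiv_nonneg_iff)
  have cq: "c = q * b + c mod b" by (simp add: q_def)
  have it: "(diff_step ^^ j) C = insert b ((\<lambda>x. x - int j * b) ` D)" if "int j \<le> q" for j
    using that
  proof (induction j)
    case 0
    then show ?case by (simp add: CD)
  next
    case (Suc j)
    let ?S = "(\<lambda>x. x - int j * b) ` D"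
    have IH: "(diff_step ^^ j) C = insert b ?S" using Suc by simp
    have ge: "b \<le> x - int j * b" if "x \<in> D" for x
    proof -
      have "(int j + 1) * b \<le> q * b" using Suc.prems b by (intro mult_right_mono) auto
      also have "\<dots> \<le> c" using cq b by (smt (verit) pos_mod_sign)
      also have "\<dots> \<le> x" using cle that .
      finally show ?thesis by (simp add: algebra_simps)
    qed
    have M: "Min (insert b ?S) = b"
      using D ge by (intro Min_eqI) auto
    have "b \<notin> ?S"
    proof
      assume "b \<in> ?S"
      then obtain x where "x \<in> D" "x = (int j + 1) * b" by (auto simp: algebra_simps)
      then show False using ndvd dvd_triv_right by blast
    qed
    then have "insert b ?S - {b} = ?S" by auto
    then have "diff_step (insert b ?S) = insert b ((\<lambda>x. x - b) ` ?S)"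
      by (simp only: diff_step_def M)
    then show ?case
      by (simp add: IH image_image algebra_simps)
  qed
  have "division_pass A = insert b ((\<lambda>x. x - q * b) ` D)"
    using it[of "nat q"] q0 by (simp add: division_pass_def Let_def C_def[symmetric]
        c_def[symmetric] MC q_def[symmetric])
  moreover have "Min (insert b ((\<lambda>x. x - q * b) ` D)) = c mod b"
  proof (rule Min_eqI)
    show "finite (insert b ((\<lambda>x. x - q * b) ` D))" using D by simp
    show "c mod b \<le> y" if y: "y \<in> insert b ((\<lambda>x. x - q * b) ` D)" for y
    proof (cases "y = b")
      case True
      then show ?thesis using b by (simp add: less_imp_le)
    next
      case False
      then obtain x where "x \<in> D" "y = x - q * b" using y by auto
      then show ?thesis using cle[of x] cq by simp
    qed
    have "c mod b = c - q * b" using cq by simp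
    then show "c mod b \<in> insert b ((\<lambda>x. x - q * b) ` D)" using c by blast
  qed
  ultimately show "Min (division_pass A) = second_Min (prune A) mod Min A"
    by (simp add: C_def c_def b_def)
qed

lemma one_mem_iff:
  assumes "admissible A"
  shows "1 \<in> A \<longleftrightarrow> \<not> 1 < Min A"
  using Min_admissible[OF assms] by (smt (verit))

lemma ex_one_mem_division_pass:
  assumes "admissible A"
  shows "\<exists>k. 1 \<in> (division_pass ^^ k) A"
  using assms
proof (induction "nat (Min A)" arbitrary: A rule: less_induct)
  case less
  show ?case
  proof (cases "1 < Min A")
    case True
    have "nat (Min (division_pass A)) < nat (Min A)"
      using Min_division_pass[OF less.prems True] True by simp
    then obtain k where "1 \<in> (division_pass ^^ k) (division_pass A)"
      using less.hyps admissible_division_pass[OF less.prems] by blast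
    then have "1 \<in> (division_pass ^^ Suc k) A" by (simp add: funpow_swap1)
    then show ?thesis by blast
  next
    case False
    then have "1 \<in> (division_pass ^^ 0) A" using one_mem_iff[OF less.prems] by simp
    then show ?thesis by blast
  qed
qed

lemma one_mem_delta_pass:
  assumes "admissible A"
  shows "1 \<in> (division_pass ^^ delta A) A"
  unfolding delta_def using LeastI_ex[OF ex_one_mem_division_pass[OF assms]] .

lemma delta_rec:
  assumes "admissible A"
  shows "delta A = (if 1 < Min A then Suc (delta (division_pass A)) else 0)"
proof (cases "1 < Min A")
  case True
  then have "1 \<notin> (division_pass ^^ 0) A" using one_mem_iff[OF assms] by simp
  then have "delta A = Suc (LEAST k. 1 \<in> (division_pass ^^ Suc k) A)"
    unfolding delta_def using one_mem_delta_pass[OF assms] by (intro Least_Suc)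
  then show ?thesis using True by (simp add: delta_def funpow_swap1)
next
  case False
  then have "1 \<in> (division_pass ^^ 0) A" using one_mem_iff[OF assms] by simp
  then have "delta A = 0" unfolding delta_def by (simp add: Least_eq_0)
  then show ?thesis using False by simp
qed

end

theory Submission
  imports Defs
begin

text \<open>
  As in Lame's theorem on the Euclidean algorithm, the passes are read backwards, with Fibonacci
  growth at each one.  Let a pass start from a set with minimum \<open>b > 1\<close> and produce a set
  \<open>S\<close> with minimum \<open>r\<close>.  Two observations suffice.  The old minimum \<open>b\<close> survives as a
  non-minimal element of \<open>S\<close> (lemma \<open>Min_mem_division_pass\<close>), so a lower bound for the
  non-minimal elements of \<open>S\<close> is one for \<open>b\<close>.  And every non-minimal element of the starting
  set is at least \<open>b + r\<close> (lemma \<open>non_minimal_ge\<close>), so lower bounds for \<open>b\<close> and \<open>r\<close>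
  add up.

  Hence, if \<open>f\<close> bounds the minimum of \<open>S\<close> and \<open>g\<close> its other elements, then \<open>g\<close> and
  \<open>f + g\<close> do the same one pass earlier.  The final set contains 1, and there the bounds are 1
  and 2; this gives consecutive Fibonacci numbers (lemma \<open>fib_delta_le\<close>).

  The bound is carried by all non-minimal elements rather than by the second smallest element of
  the pruned set.  The latter would not do for the induction: if \<open>r\<close> divides \<open>b\<close>, then \<open>b\<close>
  is discarded at the start of the next pass and never enters its division.
\<close>

text \<open>
  The minimum stays in the set as long as the subtractions keep the other elements above it: at
  each of the \<open>k\<close> steps the lower bound \<open>c\<close> of those elements is still at least \<open>b\<close>, so
  \<open>b\<close> is what is subtracted, and the step retains it.
\<close>

lemma mem_funpow_diff_step:
  assumes "finite X" "b \<in> X" "0 \<le> b"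
    and "\<And>x. x \<in> X \<Longrightarrow> x = b \<or> c \<le> x"
    and "int k * b \<le> c"
  shows "b \<in> (diff_step ^^ k) X"
  using assms
proof (induction k arbitrary: X c)
  case 0
  then show ?case by simp
next
  case (Suc k)
  have kb: "int k * b \<le> c - b" using Suc.prems(5) by (simp add: algebra_simps)
  moreover have "0 \<le> int k * b" using Suc.prems(3) by simp
  ultimately have "b \<le> c" by linarith
  then have "Min X = b" using Suc.prems(1,2,4) by (intro Min_eqI) force+
  then have step: "diff_step X = insert b ((\<lambda>x. x - b) ` (X - {b}))"
    by (simp add: diff_step_def)
  have "b \<in> (diff_step ^^ k) (diff_step X)"
  proof (rule Suc.IH[OF _ _ Suc.prems(3) _ kb])
    show "finite (diff_step X)" using Suc.prems(1) by (simp add: step)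
    show "b \<in> diff_step X" by (simp add: step)
    show "x = b \<or> c - b \<le> x" if "x \<in> diff_step X" for x
      using that Suc.prems(4) by (fastforce simp: step)
  qed
  then show ?case by (simp add: funpow_swap1)
qed

lemma second_Min_prune_mem:
  assumes "admissible A" "1 < Min A"
  shows "second_Min (prune A) \<in> prune A - {Min A}"
  using assms admissible_prune[OF assms(1)] prune_has_two[OF assms] Min_in[of "prune A - {Min A}"]
  by (simp add: second_Min_def Min_prune admissible_def)

lemma second_Min_prune_le:
  assumes "admissible A" "x \<in> prune A" "x \<noteq> Min A"
  shows "second_Min (prune A) \<le> x"
  using assms admissible_prune[OF assms(1)]
  by (simp add: second_Min_def Min_prune admissible_def)

lemma Min_mem_division_pass:
  assumes "admissible A" "1 < Min A"
  shows "Min A \<in> division_pass A"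
proof -
  define b where "b = Min A"
  define c where "c = second_Min (prune A)"
  have b: "1 < b" using assms(2) by (simp add: b_def)
  note P = admissible_prune[OF assms(1)]
  have "0 < c"
    using second_Min_prune_mem[OF assms] P by (auto simp: c_def admissible_def)
  then have "int (nat (c div b)) * b \<le> c"
    using b by (simp add: pos_imp_zdiv_nonneg_iff minus_mod_eq_div_mult[symmetric])
  then have "b \<in> (diff_step ^^ nat (c div b)) (prune A)"
  proof (rule mem_funpow_diff_step[rotated 4])
    show "finite (prune A)" using P by (simp add: admissible_def)
    show "b \<in> prune A"
      using Min_admissible(1)[OF P] Min_prune[OF assms(1)] by (simp add: b_def)
    show "x = b \<or> c \<le> x" if "x \<in> prune A" for x
      using second_Min_prune_le[OF assms(1) that] by (auto simp: b_def c_def)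
  qed (use b in simp)
  then show ?thesis
    by (simp add: division_pass_def Let_def Min_prune[OF assms(1)] b_def c_def)
qed

text \<open>
  A discarded element is a proper multiple of the minimum \<open>b\<close>, hence at least \<open>2 * b\<close>, which
  exceeds \<open>b\<close> plus the remainder.  An element that is kept is at least the dividend, whose
  quotient by \<open>b\<close> is positive.
\<close>

lemma non_minimal_ge:
  assumes "admissible A" "1 < Min A" "x \<in> A" "x \<noteq> Min A"
  shows "Min A + Min (division_pass A) \<le> x"
proof -
  define b where "b = Min A"
  define c where "c = second_Min (prune A)"
  have b: "1 < b" using assms(2) by (simp add: b_def)
  have above: "b < y" if "y \<in> A" "y \<noteq> b" for y
    using Min_admissible(3)[OF assms(1) that(1)] that(2) by (simp add: b_def)
  have r: "Min (division_pass A) = c mod b"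
    using Min_division_pass(1)[OF assms(1,2)] by (simp add: b_def c_def)
  have "b + c mod b \<le> x"
  proof (cases "x \<in> prune A")
    case True
    have "c \<in> A" "c \<noteq> b"
      using second_Min_prune_mem[OF assms(1,2)] by (auto simp: prune_def b_def c_def)
    then have "b \<le> c" using above[of c] by simp
    then have "0 < c div b" using b by (simp add: pos_imp_zdiv_pos_iff)
    then have "1 * b \<le> c div b * b" using b by (intro mult_right_mono) auto
    then have "b + c mod b \<le> c" using div_mult_mod_eq[of c b] by linarith
    also have "c \<le> x"
      using second_Min_prune_le[OF assms(1) True assms(4)] by (simp add: c_def)
    finally show ?thesis .
  next
    case False
    then have "b dvd x" using assms(3) by (auto simp: prune_def b_def)
    then have "b dvd x - b" by simp
    moreover have "0 < x - b" using above assms(3,4) by (simp add: b_def)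
    ultimately have "b \<le> x - b" by (rule zdvd_imp_le)
    moreover have "c mod b < b" using b by simp
    ultimately show ?thesis by linarith
  qed
  then show ?thesis by (simp add: r b_def)
qed

text \<open>
  Both bounds have to be proved together: in the inductive step the first one comes from the
  second one for the next set, applied to the element \<open>Min A\<close>.
\<close>

lemma fib_delta_le:
  assumes "admissible A"
  shows "int (fib (delta A + 2)) \<le> Min A"
    and "x \<in> A \<Longrightarrow> x \<noteq> Min A \<Longrightarrow> int (fib (delta A + 3)) \<le> x"
proof -
  have "int (fib (delta A + 2)) \<le> Min A \<and>
        (\<forall>x\<in>A. x \<noteq> Min A \<longrightarrow> int (fib (delta A + 3)) \<le> x)"
    using assms
  proof (induction "delta A" arbitrary: A)
    case 0
    note M = Min_admissible[OF "0.prems"]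
    have "2 \<le> x" if "x \<in> A" "x \<noteq> Min A" for x
      using M(2) M(3)[OF that(1)] that(2) by linarith
    then show ?case using M(2) by (simp add: "0.hyps"[symmetric] numeral_eq_Suc)
  next
    case (Suc d)
    have gt: "1 < Min A"
      using Suc.hyps(2) delta_rec[OF Suc.prems] by (auto split: if_splits)
    define S where "S = division_pass A"
    have d: "d = delta S"
      using Suc.hyps(2) delta_rec[OF Suc.prems] gt by (simp add: S_def)
    have S: "admissible S" using admissible_division_pass[OF Suc.prems] by (simp add: S_def)
    have less: "Min S < Min A" using Min_division_pass[OF Suc.prems gt] by (simp add: S_def)
    have r: "int (fib (d + 2)) \<le> Min S"
      using Suc.hyps(1)[OF d S] by (simp add: d)
    have b: "int (fib (d + 3)) \<le> Min A"
      using Suc.hyps(1)[OF d S] Min_mem_division_pass[OF Suc.prems gt] less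
      by (auto simp: d S_def)
    have fib: "fib (d + 4) = fib (d + 3) + fib (d + 2)" by (simp add: numeral_eq_Suc)
    have "int (fib (d + 4)) \<le> x" if "x \<in> A" "x \<noteq> Min A" for x
      using non_minimal_ge[OF Suc.prems gt that] r b by (simp add: fib S_def)
    moreover have "delta A + 2 = d + 3" "delta A + 3 = d + 4"
      using Suc.hyps(2) by simp_all
    ultimately show ?case using b by (simp only:) blast
  qed
  then show "int (fib (delta A + 2)) \<le> Min A"
    and "x \<in> A \<Longrightarrow> x \<noteq> Min A \<Longrightarrow> int (fib (delta A + 3)) \<le> x"
    by blast+
qed

theorem corollary4p6:
  fixes a :: "nat \<Rightarrow> int" and n m :: nat
  assumes "1 \<le> n"
    and "strict_mono_on {1..n} a"
    and "0 < a 1"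
    and "Gcd (a ` {1..n}) = 1"
    and "1 < a 1"
    and "a 1 < int (Fseq (m + 1)) \<or> a 2 < int (Fseq (m + 2))"
  shows "delta (a ` {1..n}) < m"
proof (rule ccontr)
  assume "\<not> delta (a ` {1..n}) < m"
  define A where "A = a ` {1..n}"
  have m: "m \<le> delta A" using \<open>\<not> delta (a ` {1..n}) < m\<close> by (simp add: A_def)
  have mono: "a 1 \<le> a i" if "i \<in> {1..n}" for i
    using strict_mono_onD[OF assms(2), of 1 i] that by (cases "i = 1") auto
  have Min: "Min A = a 1"
    unfolding A_def using mono assms(1) by (intro Min_eqI) auto
  have adm: "admissible A"
    unfolding admissible_def A_def using assms(1,3,4) mono by fastforce
  \<comment> \<open>A single integer above 1 does not have gcd 1, so \<open>a 2\<close> really is an element of the set.\<close>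
  have "n \<noteq> 1" using assms(4,5) by auto
  then have n: "2 \<le> n" using assms(1) by simp
  then have a2: "a 2 \<in> A" "a 2 \<noteq> Min A"
    unfolding Min using strict_mono_onD[OF assms(2), of 1 2] by (auto simp: A_def)
  have "fib (m + 2) \<le> fib (delta A + 2)" "fib (m + 3) \<le> fib (delta A + 3)"
    using m by (intro fib_mono; simp)+
  then have "int (fib (m + 2)) \<le> a 1" "int (fib (m + 3)) \<le> a 2"
    using fib_delta_le(1)[OF adm] fib_delta_le(2)[OF adm a2] by (simp_all add: Min)
  then show False using assms(6) by (simp add: Fseq_def numeral_eq_Suc)
qed

end
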